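(* Let $\Gamma$ be a strongly regular graph with parameters $(v,k,\lambda,\mu)$, let $d$ be a non-negative integer, and suppose $\Delta$ is a $d$-regular induced subgraph of $\Gamma$ of order $y>0$. Then $$\mathrm{Rab}_{\leq}(\Gamma,d)\leq y\leq \mathrm{Rab}_{\geq}(\Gamma,d).$$
   Context: A graph is strongly regular with parameters $(v,k,\lambda,\mu)$ if it has $v$ vertices, is $k$-regular, is neither complete nor edgeless, every two adjacent vertices have exactly $\lambda$ common neighbours, and every two distinct non-adjacent vertices have exactly $\mu$ common neighbours. The regular adjacency polynomial of $\Gamma$ is $$R_\Gamma(x,y,d)=x(x+1)(v-y)-2xyk+(2x+\lambda-\mu+1)yd+y(y-1)\mu-yd^2.$$ For a non-negative integer $d$ let $S_d=\{y\in\{d+1,\dots,v\}: R_\Gamma(x,y,d)\ge 0 \text{ for all integers } x\}$. Define $\mathrm{Rab}_{\geq}(\Gamma,d)=\max S_d$ if $S_d\neq\emptyset$ and $0$ otherwise, and $\mathrm{Rab}_{\leq}(\Gamma,d)=\min S_d$ if $S_d\ne\emptyset$ and $v+1$ otherwise. *)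

theory Defs
  imports "Graph_Theory.Graph_Theory"
begin

text \<open>
  Finite simple graphs are the AFP locale \<^locale>\<open>graph\<close>: finite digraphs without loops and
  multiple arcs whose arc relation is symmetric. Such a digraph has one outgoing arc at a vertex for
  each neighbour of it, so \<^const>\<open>out_degree\<close> is the degree in the undirected sense.
\<close>

definition regular_of_degree :: "('a, 'b) pre_digraph \<Rightarrow> nat \<Rightarrow> bool" where
  "regular_of_degree G k \<longleftrightarrow> graph G \<and> (\<forall>u \<in> verts G. out_degree G u = k)"

definition common_neighbours :: "('a, 'b) pre_digraph \<Rightarrow> 'a \<Rightarrow> 'a \<Rightarrow> 'a set" where
  "common_neighbours G u w = {z \<in> verts G. u \<rightarrow>\<^bsub>G\<^esub> z \<and> w \<rightarrow>\<^bsub>G\<^esub> z}"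

definition strongly_regular ::
  "('a, 'b) pre_digraph \<Rightarrow> nat \<Rightarrow> nat \<Rightarrow> nat \<Rightarrow> nat \<Rightarrow> bool" where
  "strongly_regular G v k l m \<longleftrightarrow>
     graph G \<and>
     card (verts G) = v \<and>
     regular_of_degree G k \<and>
     \<not> complete_digraph (card (verts G)) G \<and>
     arcs G \<noteq> {} \<and>
     (\<forall>u \<in> verts G. \<forall>w \<in> verts G.
        u \<rightarrow>\<^bsub>G\<^esub> w \<longrightarrow> card (common_neighbours G u w) = l) \<and>
     (\<forall>u \<in> verts G. \<forall>w \<in> verts G.
        u \<noteq> w \<and> \<not> u \<rightarrow>\<^bsub>G\<^esub> w \<longrightarrow> card (common_neighbours G u w) = m)"

text \<open>
  The regular adjacency polynomial and the bounds built from it depend on a strongly regular graph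
  only through its parameters \<open>(v, k, \<lambda>, \<mu>)\<close>, which here take the place of the graph as the arguments
  \<open>v\<close>, \<open>k\<close>, \<open>l\<close>, \<open>m\<close>. The values of the polynomial are integers; no subtraction is truncated.
\<close>

definition reg_adj_poly ::
  "nat \<Rightarrow> nat \<Rightarrow> nat \<Rightarrow> nat \<Rightarrow> int \<Rightarrow> int \<Rightarrow> int \<Rightarrow> int" where
  "reg_adj_poly v k l m x y d =
     x * (x + 1) * (int v - y) - 2 * x * y * int k
     + (2 * x + int l - int m + 1) * y * d + y * (y - 1) * int m - y * d\<^sup>2"

definition Rab_set :: "nat \<Rightarrow> nat \<Rightarrow> nat \<Rightarrow> nat \<Rightarrow> nat \<Rightarrow> nat set" where
  "Rab_set v k l m d =
     {y \<in> {d + 1..v}. \<forall>x :: int. reg_adj_poly v k l m x (int y) (int d) \<ge> 0}"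

definition Rab_upper :: "nat \<Rightarrow> nat \<Rightarrow> nat \<Rightarrow> nat \<Rightarrow> nat \<Rightarrow> nat" where
  "Rab_upper v k l m d =
     (if Rab_set v k l m d \<noteq> {} then Max (Rab_set v k l m d) else 0)"

definition Rab_lower :: "nat \<Rightarrow> nat \<Rightarrow> nat \<Rightarrow> nat \<Rightarrow> nat \<Rightarrow> nat" where
  "Rab_lower v k l m d =
     (if Rab_set v k l m d \<noteq> {} then Min (Rab_set v k l m d) else v + 1)"

end

(* For a vertex u outside Delta let a(u) be its number of neighbours in Delta.
   Double counting edges and paths of length two expresses the first two moments of a over the
   outside vertices in terms of the parameters, and the regular adjacency polynomial at x turns out
   to be the sum of (a(u) - x) * (a(u) - x - 1). Each summand is a product of two consecutive
   integers, hence non-negative, so y belongs to the set whose extrema are the two bounds. *)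
theory Submission
  imports Defs
begin

lemma prod_consecutive_int_nonneg: "0 \<le> z * (z - 1)" for z :: int
  by (cases "z \<le> 0") (auto simp: zero_le_mult_iff)

text \<open>The square of a count enumerates ordered pairs \<open>(s, t)\<close>, diagonal included.
  Exchanging the sums groups by pair instead of by \<open>u\<close>, which reduces a second moment
  to numbers of common neighbours.\<close>

lemma sum_card_square:
  fixes P :: "'a \<Rightarrow> 'b \<Rightarrow> bool"
  assumes "finite V" "finite S"
  shows "(\<Sum>u\<in>V. (int (card {s \<in> S. P u s}))\<^sup>2) =
    (\<Sum>s\<in>S. \<Sum>t\<in>S. int (card {u \<in> V. P u s \<and> P u t}))"
proof -
  have "(\<Sum>u\<in>V. (int (card {s \<in> S. P u s}))\<^sup>2) =
      (\<Sum>u\<in>V. \<Sum>s\<in>S. \<Sum>t\<in>S. of_bool (P u s \<and> P u t))"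
  proof (rule sum.cong[OF refl])
    fix u
    have "int (card {s \<in> S. P u s}) = (\<Sum>s\<in>S. of_bool (P u s))"
      using assms by (simp add: Int_def)
    then show "(int (card {s \<in> S. P u s}))\<^sup>2 =
        (\<Sum>s\<in>S. \<Sum>t\<in>S. of_bool (P u s \<and> P u t))"
      by (simp only: power2_eq_square sum_product of_bool_conj)
  qed
  also have "\<dots> = (\<Sum>s\<in>S. \<Sum>t\<in>S. \<Sum>u\<in>V. of_bool (P u s \<and> P u t))"
    by (subst sum.swap) (intro sum.cong refl sum.swap)
  also have "\<dots> = (\<Sum>s\<in>S. \<Sum>t\<in>S. int (card {u \<in> V. P u s \<and> P u t}))"
    using assms by (simp add: Int_def)
  finally show ?thesis .
qed

context nomulti_digraph
begin

text \<open>Degrees count arcs, while the double counting needs neighbours. Without parallel arcs,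
  \<open>head G\<close> is injective on the arcs leaving \<open>u\<close>.\<close>

lemma out_degree_eq_card_dominated: "out_degree G u = card {w. u \<rightarrow> w}"
proof -
  have "inj_on (head G) (out_arcs G u)"
    by (auto intro!: inj_onI no_multi_arcs simp: arc_to_ends_def)
  moreover have "head G ` out_arcs G u = {w. u \<rightarrow> w}"
    by (auto simp: arcs_ends_conv out_arcs_def)
  ultimately show ?thesis
    unfolding out_degree_def by (metis card_image)
qed

end

lemma induced_subgraph_dominates_iff:
  assumes "induced_subgraph H G"
  shows "u \<rightarrow>\<^bsub>H\<^esub> w \<longleftrightarrow> u \<in> verts H \<and> w \<in> verts H \<and> u \<rightarrow>\<^bsub>G\<^esub> w"
  using assms by (auto simp: induced_subgraph_def subgraph_def compatible_def arcs_ends_conv)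

text \<open>Both moments of \<open>a\<close> are computed over all of \<open>verts G\<close>, and
  the part from \<open>verts H\<close>, where \<open>a\<close> is constantly \<open>d\<close>, is
  then subtracted. Expanding the summand in powers of \<open>a u\<close> leaves only these moments
  and the number of outside vertices.\<close>

lemma reg_adj_poly_eq_sum:
  assumes srg: "strongly_regular G v k l m"
    and ind: "induced_subgraph H G"
    and reg: "regular_of_degree H d"
  defines "a \<equiv> \<lambda>u. int (card {s \<in> verts H. u \<rightarrow>\<^bsub>G\<^esub> s})"
  shows "reg_adj_poly v k l m x (int (card (verts H))) (int d) =
    (\<Sum>u \<in> verts G - verts H. (a u - x) * (a u - x - 1))"
proof -
  interpret G: graph G
    using srg by (simp add: strongly_regular_def)
  interpret H: graph H
    using reg by (simp add: regular_of_degree_def)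
  let ?V = "verts G" and ?S = "verts H"
  define y where "y = int (card ?S)"
  have finV: "finite ?V" and finS: "finite ?S" and SV: "?S \<subseteq> ?V"
    using ind by (auto simp: induced_subgraph_def subgraph_def)
  have sym: "u \<rightarrow>\<^bsub>G\<^esub> w \<longleftrightarrow> w \<rightarrow>\<^bsub>G\<^esub> u" for u w
    using G.sym_arcs by (auto simp: symmetric_def dest: symD)
  have irrefl: "\<not> u \<rightarrow>\<^bsub>G\<^esub> u" for u
    by (auto simp: arcs_ends_conv dest: G.no_loops)
  have deg: "card {w \<in> ?V. u \<rightarrow>\<^bsub>G\<^esub> w} = k" if "u \<in> ?V" for u
  proof -
    have "{w \<in> ?V. u \<rightarrow>\<^bsub>G\<^esub> w} = {w. u \<rightarrow>\<^bsub>G\<^esub> w}"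
      by (auto simp: arcs_ends_conv)
    then show ?thesis
      using srg that
      by (simp add: strongly_regular_def regular_of_degree_def G.out_degree_eq_card_dominated)
  qed
  \<comment> \<open>Since \<open>H\<close> is induced, a neighbour in \<open>G\<close> that lies in
    \<open>verts H\<close> is already a neighbour in \<open>H\<close>.\<close>
  have inner: "card {t \<in> ?S. s \<rightarrow>\<^bsub>G\<^esub> t} = d" if "s \<in> ?S" for s
  proof -
    have "{t \<in> ?S. s \<rightarrow>\<^bsub>G\<^esub> t} = {t. s \<rightarrow>\<^bsub>H\<^esub> t}"
      using that by (auto simp: induced_subgraph_dominates_iff[OF ind])
    then show ?thesis
      using reg that by (simp add: regular_of_degree_def H.out_degree_eq_card_dominated)
  qed
  \<comment> \<open>The cases equal, adjacent and non-adjacent are merged into one expression,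
    linear in indicators, so that it can be summed over \<open>t\<close>. Irreflexivity keeps the
    two indicators from both being 1.\<close>
  have common: "int (card {u \<in> ?V. u \<rightarrow>\<^bsub>G\<^esub> s \<and> u \<rightarrow>\<^bsub>G\<^esub> t}) =
      int m + of_bool (t = s) * (int k - int m) + of_bool (s \<rightarrow>\<^bsub>G\<^esub> t) * (int l - int m)"
    if "s \<in> ?V" "t \<in> ?V" for s t
  proof -
    have "{u \<in> ?V. u \<rightarrow>\<^bsub>G\<^esub> s \<and> u \<rightarrow>\<^bsub>G\<^esub> t} = common_neighbours G s t"
      by (auto simp: common_neighbours_def sym)
    moreover have "card (common_neighbours G s t) =
        (if t = s then k else if s \<rightarrow>\<^bsub>G\<^esub> t then l else m)"
      using srg that deg[of s] by (auto simp: strongly_regular_def common_neighbours_def)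
    ultimately show ?thesis
      using irrefl by auto
  qed
  have "(\<Sum>u\<in>?V. a u) = (\<Sum>u\<in>?V. \<Sum>s\<in>?S. of_bool (u \<rightarrow>\<^bsub>G\<^esub> s))"
    using finS by (simp add: a_def Int_def)
  also have "\<dots> = (\<Sum>s\<in>?S. int (card {u \<in> ?V. s \<rightarrow>\<^bsub>G\<^esub> u}))"
    using finV by (subst sum.swap) (simp add: Int_def sym)
  also have "\<dots> = y * int k"
    using SV deg by (simp add: y_def subset_iff)
  finally have total: "(\<Sum>u\<in>?V. a u) = y * int k" .
  \<comment> \<open>For fixed \<open>s\<close>, each of the \<open>y\<close> choices of
    \<open>t\<close> contributes \<open>m\<close>; this is corrected once for \<open>t = s\<close>
    and \<open>d\<close> times for the neighbours of \<open>s\<close> in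
    \<open>verts H\<close>.\<close>
  have row: "(\<Sum>t\<in>?S. int (card {u \<in> ?V. u \<rightarrow>\<^bsub>G\<^esub> s \<and> u \<rightarrow>\<^bsub>G\<^esub> t})) =
      y * int m + (int k - int m) + int d * (int l - int m)" if s: "s \<in> ?S" for s
  proof -
    have "(\<Sum>t\<in>?S. int (card {u \<in> ?V. u \<rightarrow>\<^bsub>G\<^esub> s \<and> u \<rightarrow>\<^bsub>G\<^esub> t})) =
        (\<Sum>t\<in>?S. int m + of_bool (t = s) * (int k - int m)
          + of_bool (s \<rightarrow>\<^bsub>G\<^esub> t) * (int l - int m))"
      using s SV by (intro sum.cong refl common) auto
    also have "\<dots> = y * int m + (\<Sum>t\<in>?S. of_bool (t = s)) * (int k - int m)
        + (\<Sum>t\<in>?S. of_bool (s \<rightarrow>\<^bsub>G\<^esub> t)) * (int l - int m)"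
      by (simp only: sum.distrib sum_constant sum_distrib_right y_def of_nat_mult)
    also have "(\<Sum>t\<in>?S. of_bool (t = s)) = (1::int)"
      using s finS by (simp add: of_bool_def)
    also have "(\<Sum>t\<in>?S. of_bool (s \<rightarrow>\<^bsub>G\<^esub> t)) = int d"
      using s finS inner by (simp add: Int_def)
    finally show ?thesis by simp
  qed
  have total2: "(\<Sum>u\<in>?V. (a u)\<^sup>2) = y * (y * int m + (int k - int m) + int d * (int l - int m))"
    using finV finS by (simp add: a_def sum_card_square row y_def)
  have insum: "(\<Sum>u\<in>?S. a u) = y * int d" "(\<Sum>u\<in>?S. (a u)\<^sup>2) = y * (int d)\<^sup>2"
    by (simp_all add: a_def inner y_def)
  have card_out: "int (card (?V - ?S)) = int v - y"
    using srg SV finV finS card_mono[OF finV SV]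
    by (auto simp: strongly_regular_def y_def card_Diff_subset of_nat_diff)
  have "(\<Sum>u\<in>?V - ?S. (a u - x) * (a u - x - 1)) =
      (\<Sum>u\<in>?V - ?S. (a u)\<^sup>2 - (2 * x + 1) * a u + x * (x + 1))"
    by (intro sum.cong refl) (simp add: algebra_simps power2_eq_square)
  also have "\<dots> = (\<Sum>u\<in>?V - ?S. (a u)\<^sup>2) - (2 * x + 1) * (\<Sum>u\<in>?V - ?S. a u)
      + int (card (?V - ?S)) * (x * (x + 1))"
    by (simp only: sum.distrib sum_subtractf sum_constant sum_distrib_left)
  also have "\<dots> = reg_adj_poly v k l m x y (int d)"
    unfolding sum_diff[OF finV SV] total total2 insum card_out reg_adj_poly_def
    by (simp add: algebra_simps power2_eq_square)
  finally show ?thesis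
    by (simp add: y_def)
qed

text \<open>In a loopless graph a vertex is missing from its own neighbourhood, which is therefore a
  proper subset of the vertices. This yields the lower end \<open>d + 1\<close> of the range in
  \<open>Rab_set\<close>.\<close>

lemma regular_of_degree_less_card:
  assumes "regular_of_degree H d" "verts H \<noteq> {}"
  shows "d < card (verts H)"
proof -
  interpret H: graph H
    using assms(1) by (simp add: regular_of_degree_def)
  obtain s where s: "s \<in> verts H" using assms(2) by blast
  have "{w. s \<rightarrow>\<^bsub>H\<^esub> w} \<subset> verts H"
  proof
    show "{w. s \<rightarrow>\<^bsub>H\<^esub> w} \<subseteq> verts H"
      by (auto simp: arcs_ends_conv)
    have "\<not> s \<rightarrow>\<^bsub>H\<^esub> s"
      by (auto simp: arcs_ends_conv dest: H.no_loops)
    then show "{w. s \<rightarrow>\<^bsub>H\<^esub> w} \<noteq> verts H"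
      using s by blast
  qed
  then have "card {w. s \<rightarrow>\<^bsub>H\<^esub> w} < card (verts H)"
    by (intro psubset_card_mono) auto
  then show ?thesis
    using assms(1) s by (simp add: regular_of_degree_def H.out_degree_eq_card_dominated)
qed

theorem theorem4p2:
  fixes \<Gamma> \<Delta> :: "('a, 'b) pre_digraph" and v k l m d y :: nat
  assumes "strongly_regular \<Gamma> v k l m"
    and "induced_subgraph \<Delta> \<Gamma>"
    and "regular_of_degree \<Delta> d"
    and "card (verts \<Delta>) = y"
    and "y > 0"
  shows "Rab_lower v k l m d \<le> y \<and> y \<le> Rab_upper v k l m d"
proof -
  interpret graph \<Gamma>
    using assms(1) by (simp add: strongly_regular_def)
  have "d < y"
    using regular_of_degree_less_card[OF assms(3)] assms(4,5) by fastforce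
  moreover have "y \<le> v"
    using assms(1,2,4)
    by (auto simp: strongly_regular_def induced_subgraph_def subgraph_def intro!: card_mono)
  \<comment> \<open>Each summand has the form \<open>z * (z - 1)\<close> with
    \<open>z = a u - x\<close>, where \<open>a u\<close> is the number of neighbours of
    \<open>u\<close> in \<Delta>.\<close>
  moreover have "0 \<le> reg_adj_poly v k l m x (int y) (int d)" for x
    unfolding assms(4)[symmetric] reg_adj_poly_eq_sum[OF assms(1-3)]
    by (intro sum_nonneg prod_consecutive_int_nonneg)
  ultimately have "y \<in> Rab_set v k l m d"
    by (simp add: Rab_set_def)
  moreover have "finite (Rab_set v k l m d)"
    by (simp add: Rab_set_def)
  \<comment> \<open>Membership of \<open>y\<close> rules out the default values \<open>0\<close> and
    \<open>v + 1\<close>; finiteness puts \<open>y\<close> between \<open>Min\<close> and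
    \<open>Max\<close>.\<close>
  ultimately show ?thesis
    by (auto simp: Rab_lower_def Rab_upper_def)
qed

end
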